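(* Let $\tau>0$ and let $(y_n,z_n)_{n\ge0}$, $(Y_n,Z_n)_{n\ge0}$, $(Y_n',Z_n')_{n\ge0}$, where $Y_n=(Y_{n1},\dots,Y_{ns})$ and similarly for $Z_n,Y_n',Z_n'$, be a solution of the $s$-stage implicit Runge-Kutta discretization $$y_{n+1}=y_n+\tau\sum_{j=1}^s\beta_jY_{nj}',\qquad z_{n+1}=z_n+\tau\sum_{j=1}^s\beta_jZ_{nj}',$$ $$Y_{ni}=y_n+\tau\sum_{j=1}^s\alpha_{ij}Y_{nj}',\qquad Z_{ni}=z_n+\tau\sum_{j=1}^s\alpha_{ij}Z_{nj}',\qquad i=1,\dots,s,$$ $$M(Y_{nj})Y_{nj}'+F(Y_{nj})=C^\top Z_{nj},\qquad E Z_{nj}'+AZ_{nj}=BY_{nj},\qquad j=1,\dots,s,$$ for all $n\ge0$, with initial values $y_0=0$ and $z_0=0$. Let the weight matrices $(W_n)_{n\ge0}$ be the coefficients of the power series expansion about $\xi=0$ $$\widehat K\Big(\frac{\Delta(\xi)}{\tau}\Big)=\sum_{n=0}^\infty W_n\xi^n,$$ where $$\Delta(\xi)=\Big(\frac{\xi}{1-\xi}\,\underline 1\,\beta^\top+\mathcal A\Big)^{-1},\qquad \widehat K\Big(\frac{\Delta(\xi)}{\tau}\Big):=(I\otimes C^\top)\Big(\frac{\Delta(\xi)}{\tau}\otimes E+I\otimes A\Big)^{-1}(I\otimes B),$$ and let $W_{n,ij}$, $1\le i,j\le s$, denote the blocks of $W_n$ corresponding to the individual stages. Then for all $n\ge0$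 $$y_{n+1}=y_n+\tau\sum_{j=1}^s\beta_jY_{nj}',$$ with stages and slopes satisfying, for $i=1,\dots,s$, $$M(Y_{ni})Y_{ni}'+F(Y_{ni})=\sum_{k=0}^n\sum_{j=1}^sW_{n-k,ij}Y_{kj},\qquad Y_{ni}=y_n+\tau\sum_{j=1}^s\alpha_{ij}Y_{nj}'.$$
   Context: The underlying coupled system is $M(y)\,\partial_t y+F(y)=C^\top z$, $E\,\partial_t z+Az=By$, $y(0)=0$, $z(0)=0$, which is finite dimensional: $y$ takes values in $\mathbb R^p$, $z$ in $\mathbb R^q$; $M:\mathbb R^p\to\mathbb R^{p\times p}$ and $F:\mathbb R^p\to\mathbb R^p$ are given (possibly nonlinear) functions; $E,A\in\mathbb R^{q\times q}$ and $B,C\in\mathbb R^{q\times p}$ are given constant matrices. The matrices $M(y)$ and $E$ are not required to be regular. The Runge-Kutta method has coefficient matrix $\mathcal A=(\alpha_{ij})_{i,j=1}^s\in\mathbb R^{s\times s}$ and weight vector $\beta=(\beta_1,\dots,\beta_s)^\top\in\mathbb R^s$ (the methods of interest in the paper are the Radau-IIA methods). The vector $\underline 1=(1,\dots,1)^\top\in\mathbb R^s$, $I$ is the $s\times s$ identity matrix, and $\otimes$ is the Kronecker product. Stacked vectors such as $Y_n\in\mathbb R^{sp}$ are ordered by stages, so each $W_n\in\mathbb R^{sp\times sp}$ is partitioned into $s\times s$ blocks $W_{n,ij}\in\mathbb R^{p\times p}$. The matrix $A$ (system matrix) is distinct from $\mathcal A$ (Runge-Kutta matrix). It is assumed that $\mathcal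 A$ is invertible and that $\frac1\tau\mathcal A^{-1}\otimes E+I\otimes A$ is invertible, so that $\Delta(\xi)$ and $\widehat K(\Delta(\xi)/\tau)$ are analytic near $\xi=0$ and the weights are well defined. *)

theory Defs
  imports "HOL-Analysis.Analysis"
begin

text \<open>
  Stacked vectors in $R^{sp}$ are indexed by pairs (stage, component), i.e. ordered by stages.
\<close>

definition kron :: "real^'n^'m \<Rightarrow> real^'b^'a \<Rightarrow> real^('n \<times> 'b)^('m \<times> 'a)"
    (infixl "\<otimes>\<^sub>K" 70) where
  "X \<otimes>\<^sub>K Y = (\<chi> r c. X $ fst r $ fst c * Y $ snd r $ snd c)"

definition block :: "real^('s::finite \<times> 'b)^('s \<times> 'a) \<Rightarrow> 's \<Rightarrow> 's \<Rightarrow> real^'b^'a" where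
  "block W i j = (\<chi> a b. W $ (i, a) $ (j, b))"

definition outer :: "real^'m \<Rightarrow> real^'n \<Rightarrow> real^'n^'m" where
  "outer u v = (\<chi> i j. u $ i * v $ j)"

text \<open>In \<open>rk_Delta\<close>, the \<open>1\<close> passed to \<open>outer\<close> is the all-ones vector.\<close>

definition rk_Delta :: "real^'s^'s \<Rightarrow> real^'s \<Rightarrow> real \<Rightarrow> real^'s^'s" where
  "rk_Delta \<A> \<beta> \<xi> = matrix_inv ((\<xi> / (1 - \<xi>)) *\<^sub>R outer 1 \<beta> + \<A>)"

definition Khat ::
  "real^'q^'q \<Rightarrow> real^'q^'q \<Rightarrow> real^'p^'q \<Rightarrow> real^'p^'q \<Rightarrow> real^'s^'s
    \<Rightarrow> real^('s \<times> 'p)^('s \<times> 'p)" where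
  "Khat E A B C X =
     (mat 1 \<otimes>\<^sub>K transpose C) ** matrix_inv (X \<otimes>\<^sub>K E + mat 1 \<otimes>\<^sub>K A) ** (mat 1 \<otimes>\<^sub>K B)"

text \<open>
  The expansion is required only for real arguments near \<open>0\<close>; all data are real, and this already
  determines the coefficients, which agree with those of the expansion in a complex argument.
\<close>

definition has_power_series_at_0 ::
  "(real \<Rightarrow> 'a::real_normed_vector) \<Rightarrow> (nat \<Rightarrow> 'a) \<Rightarrow> bool" where
  "has_power_series_at_0 f W \<longleftrightarrow>
     (\<exists>r>0. \<forall>\<xi>. \<bar>\<xi>\<bar> < r \<longrightarrow> (\<lambda>n. \<xi> ^ n *\<^sub>R W n) sums f \<xi>)"

end

theory Submission
  imports Defs
begin

text \<open>
  Write \<open>D(x) = x / (1 - x) 1 \<beta>\<^sup>T + \<A>\<close>, so that \<open>\<Delta>(x) = D(x)\<^sup>-\<^sup>1\<close>. The Runge-Kutta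
  equations for \<open>z\<close>, started at \<open>0\<close>, say that the generating functions of stages and slopes
  are related by \<open>Z(x) = \<tau> D(x) Z'(x)\<close>, that is \<open>Z'(x) = (\<Delta>(x) / \<tau>) Z(x)\<close>. Inserted into
  \<open>E Z' + A Z = B Y\<close> this gives \<open>(\<Delta>(x) / \<tau> \<otimes> E + I \<otimes> A) Z(x) = (I \<otimes> B) Y(x)\<close>, and hence
  \<open>(I \<otimes> C\<^sup>T) Z(x) = K(\<Delta>(x) / \<tau>) Y(x)\<close>. Comparing coefficients turns the right-hand side into
  the discrete convolution of the weights with the stages of \<open>y\<close>; the nonlinear equation for \<open>y\<close>
  enters only through the term \<open>C\<^sup>T Z\<close>.

  Since \<open>M\<close> and \<open>F\<close> are arbitrary, the stages may grow so fast that these generating functions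
  converge only at \<open>x = 0\<close>. The argument is therefore carried out with the polynomials
  obtained by truncation after a fixed order \<open>N\<close>. The relation between stages and slopes then
  acquires a remainder \<open>x ^ (N + 1) / (1 - x)\<close> times a constant vector
  (\<open>rk_truncated_generating_function\<close>), and the identity for \<open>C\<^sup>T Z\<close> acquires a remainder
  \<open>x ^ (N + 1) S(x)\<close>. Here \<open>S\<close> has a limit at \<open>0\<close>, because the two matrices that are inverted
  are continuous and invertible at \<open>0\<close> (\<open>tendsto_matrix_inv\<close>). A power series that is
  \<open>x ^ (N + 1)\<close> times such an \<open>S\<close> has no coefficients up to order \<open>N\<close>
  (\<open>power_series_coeff_eq_0\<close>), which gives the claim at step \<open>N\<close>.
\<close>

section \<open>Continuity of the matrix inverse\<close>

lemma tendsto_det: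
  fixes f :: "'a \<Rightarrow> real^'n^'n"
  assumes "(f \<longlongrightarrow> L) F"
  shows "((\<lambda>x. det (f x)) \<longlongrightarrow> det L) F"
  unfolding det_def by (intro tendsto_intros assms)

lemma eventually_invertible:
  fixes f :: "'a \<Rightarrow> real^'n^'n"
  assumes "(f \<longlongrightarrow> L) F" and "invertible L"
  shows "\<forall>\<^sub>F x in F. invertible (f x)"
  using tendsto_imp_eventually_ne[OF tendsto_det[OF assms(1)]] assms(2)
  by (simp add: invertible_det_nz)

lemma
  fixes A :: "'a::semiring_1^'n^'m"
  assumes "invertible A"
  shows matrix_inv_right: "A ** matrix_inv A = mat 1"
    and matrix_inv_left: "matrix_inv A ** A = mat 1"
  using someI_ex[OF assms[unfolded invertible_def]] by (auto simp: matrix_inv_def)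

lemma matrix_inv_nth_Cramer:
  fixes A :: "real^'n^'n"
  assumes "invertible A"
  shows "matrix_inv A $ k $ l =
    det (\<chi> i j. if j = k then axis l 1 $ i else A $ i $ j) / det A"
proof -
  have "A *v (matrix_inv A *v axis l 1) = axis l 1"
    by (simp add: matrix_vector_mul_assoc matrix_inv_right[OF assms])
  then have "matrix_inv A *v axis l 1 =
      (\<chi> k. det (\<chi> i j. if j = k then axis l 1 $ i else A $ i $ j) / det A)"
    by (rule cramer[THEN iffD1, OF assms[unfolded invertible_det_nz]])
  then show ?thesis
    by (simp add: vec_eq_iff matrix_vector_mult_basis column_def)
qed

text \<open>By Cramer's rule the entries of the inverse are quotients of determinants, and the
  denominator does not vanish in the limit.\<close>

lemma tendsto_matrix_inv:
  fixes f :: "'a \<Rightarrow> real^'n^'n"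
  assumes lim: "(f \<longlongrightarrow> L) F" and inv: "invertible L"
  shows "((\<lambda>x. matrix_inv (f x)) \<longlongrightarrow> matrix_inv L) F"
proof (intro vec_tendstoI)
  fix k l
  have minor: "((\<lambda>x. (\<chi> i j. if j = k then axis l 1 $ i else f x $ i $ j) :: real^'n^'n)
      \<longlongrightarrow> (\<chi> i j. if j = k then axis l 1 $ i else L $ i $ j)) F"
    by (intro vec_tendstoI) (auto intro!: tendsto_intros lim)
  have "((\<lambda>x. det (\<chi> i j. if j = k then axis l 1 $ i else f x $ i $ j) / det (f x))
      \<longlongrightarrow> matrix_inv L $ k $ l) F"
    unfolding matrix_inv_nth_Cramer[OF inv]
    using inv by (intro tendsto_divide tendsto_det minor lim) (simp add: invertible_det_nz)
  moreover have "\<forall>\<^sub>F x in F. det (\<chi> i j. if j = k then axis l 1 $ i else f x $ i $ j) / det (f x)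
      = matrix_inv (f x) $ k $ l"
    using eventually_invertible[OF lim inv]
    by eventually_elim (simp add: matrix_inv_nth_Cramer)
  ultimately show "((\<lambda>x. matrix_inv (f x) $ k $ l) \<longlongrightarrow> matrix_inv L $ k $ l) F"
    by (rule Lim_transform_eventually)
qed

lemma tendsto_matrix_vector_mult:
  fixes f :: "'a \<Rightarrow> real^'n^'m"
  assumes "(f \<longlongrightarrow> L) F" and "(g \<longlongrightarrow> v) F"
  shows "((\<lambda>x. f x *v g x) \<longlongrightarrow> L *v v) F"
  unfolding matrix_vector_mult_def by (intro tendsto_intros assms)

section \<open>Stacked vectors and Kronecker products\<close>

definition stack :: "('s::finite \<Rightarrow> real^'a) \<Rightarrow> real^('s \<times> 'a)" where
  "stack V = (\<chi> r. V (fst r) $ snd r)"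

lemma stack_nth: "stack V $ (i, a) = V i $ a"
  by (simp add: stack_def)

lemma stack_add: "stack V + stack V' = stack (\<lambda>i. V i + V' i)"
  by (simp add: vec_eq_iff stack_def)

lemma stack_scaleR: "c *\<^sub>R stack V = stack (\<lambda>i. c *\<^sub>R V i)"
  by (simp add: vec_eq_iff stack_def)

lemma stack_sum: "(\<Sum>n\<in>I. stack (V n)) = stack (\<lambda>i. \<Sum>n\<in>I. V n i)"
  by (simp add: vec_eq_iff stack_def)

lemma kron_mult_stack:
  "(X \<otimes>\<^sub>K P) *v stack V = stack (\<lambda>i. P *v (\<Sum>j\<in>UNIV. X $ i $ j *\<^sub>R V j))"
proof -
  have "(\<Sum>c\<in>UNIV. X $ i $ fst c * P $ a $ snd c * V (fst c) $ snd c)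
      = (\<Sum>b\<in>UNIV. P $ a $ b * (\<Sum>j\<in>UNIV. X $ i $ j * V j $ b))" for i a
  proof -
    have "(\<Sum>c\<in>UNIV. X $ i $ fst c * P $ a $ snd c * V (fst c) $ snd c)
        = (\<Sum>j\<in>UNIV. \<Sum>b\<in>UNIV. X $ i $ j * P $ a $ b * V j $ b)"
      unfolding sum.cartesian_product UNIV_Times_UNIV by (simp add: case_prod_beta)
    also have "\<dots> = (\<Sum>b\<in>UNIV. P $ a $ b * (\<Sum>j\<in>UNIV. X $ i $ j * V j $ b))"
      by (subst sum.swap) (simp add: sum_distrib_left mult_ac)
    finally show ?thesis .
  qed
  then show ?thesis
    by (simp add: vec_eq_iff kron_def stack_def matrix_vector_mult_def)
qed

lemma kron_mat1_mult_stack: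
  fixes V :: "'s::finite \<Rightarrow> real^'a"
  shows "(mat 1 \<otimes>\<^sub>K P) *v stack V = stack (\<lambda>i. P *v V i)"
proof -
  have "(\<Sum>j\<in>UNIV. (mat 1 :: real^'s^'s) $ i $ j *\<^sub>R V j) = V i" for i
    by (simp add: mat_def if_distrib[of "\<lambda>t. t *\<^sub>R _"] cong: if_cong)
  then show ?thesis
    by (simp add: kron_mult_stack)
qed

text \<open>With \<open>P = \<Delta> / \<tau>\<close> and \<open>Q = \<tau> D\<close> this recovers the slopes from the stages.\<close>

lemma kron_mult_stack_cancel:
  fixes P Q :: "real^'s^'s"
  assumes "P ** Q = mat 1"
  shows "(P \<otimes>\<^sub>K K) *v stack (\<lambda>i. \<Sum>j\<in>UNIV. Q $ i $ j *\<^sub>R V j) = stack (\<lambda>i. K *v V i)"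
proof -
  have "(\<Sum>j\<in>UNIV. P $ i $ j *\<^sub>R (\<Sum>k\<in>UNIV. Q $ j $ k *\<^sub>R V k)) = V i" for i
  proof -
    have "(\<Sum>j\<in>UNIV. P $ i $ j *\<^sub>R (\<Sum>k\<in>UNIV. Q $ j $ k *\<^sub>R V k))
        = (\<Sum>k\<in>UNIV. (P ** Q) $ i $ k *\<^sub>R V k)"
      unfolding scaleR_sum_right
      by (subst sum.swap) (simp add: matrix_matrix_mult_def scaleR_sum_left)
    also have "\<dots> = V i"
      by (simp add: assms mat_def if_distrib[of "\<lambda>t. t *\<^sub>R _"] cong: if_cong)
    finally show ?thesis .
  qed
  then show ?thesis
    by (simp add: kron_mult_stack)
qed

lemma matrix_mult_stack_nth:
  "(W *v stack V) $ (i, a) = (\<Sum>j\<in>UNIV. block W i j *v V j) $ a"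
proof -
  have "(\<Sum>c\<in>UNIV. W $ (i, a) $ c * V (fst c) $ snd c)
      = (\<Sum>j\<in>UNIV. \<Sum>b\<in>UNIV. W $ (i, a) $ (j, b) * V j $ b)"
    unfolding sum.cartesian_product UNIV_Times_UNIV by (simp add: case_prod_beta)
  then show ?thesis
    by (simp add: matrix_vector_mult_def stack_def block_def)
qed

lemma tendsto_kron:
  assumes "(f \<longlongrightarrow> X) F"
  shows "((\<lambda>x. f x \<otimes>\<^sub>K P) \<longlongrightarrow> X \<otimes>\<^sub>K P) F"
  unfolding kron_def by (intro tendsto_intros assms)

section \<open>Power series that vanish to high order\<close>

text \<open>If all earlier coefficients vanish, dividing by \<open>x ^ n\<close> leaves a power series with
  constant term \<open>c n\<close> and, since \<open>n \<le> N\<close>, with limit \<open>0\<close> at the origin. Pairing with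
  \<open>c n\<close> itself reduces this to a real power series.\<close>

lemma power_series_coeff_eq_0:
  fixes c :: "nat \<Rightarrow> 'a::real_inner"
  assumes r: "r > 0"
    and sums: "\<And>x::real. \<bar>x\<bar> < r \<Longrightarrow> (\<lambda>n. x ^ n *\<^sub>R c n) sums f x"
    and f: "\<forall>\<^sub>F x in at 0. f x = x ^ Suc N *\<^sub>R S x"
    and S: "(S \<longlongrightarrow> L) (at 0)"
  shows "n \<le> N \<Longrightarrow> c n = 0"
proof (induction n rule: less_induct)
  case (less n)
  define g where "g x = (inverse (x ^ n) *\<^sub>R f x) \<bullet> c n" for x
  have tail: "(\<lambda>i. (c (i + n) \<bullet> c n) * x ^ i) sums g x" if "x \<noteq> 0" "\<bar>x\<bar> < r" for x
  proof -
    have "(\<Sum>i<n. x ^ i *\<^sub>R c i) = 0"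
      using less by (intro sum.neutral) auto
    with sums[OF that(2)] have "(\<lambda>i. x ^ (i + n) *\<^sub>R c (i + n)) sums f x"
      using sums_iff_shift[of "\<lambda>i. x ^ i *\<^sub>R c i" n "f x"] by simp
    then have "(\<lambda>i. (inverse (x ^ n) *\<^sub>R x ^ (i + n) *\<^sub>R c (i + n)) \<bullet> c n) sums g x"
      unfolding g_def
      by (intro bounded_linear.sums[OF bounded_linear_inner_left] sums_scaleR_right)
    then show ?thesis
      using that(1) by (simp add: power_add mult_ac)
  qed
  have "(g \<longlongrightarrow> c (0 + n) \<bullet> c n) (at 0)"
    by (rule powser_limit_0_strong[OF r]) (use tail in auto)
  moreover have "(g \<longlongrightarrow> 0) (at 0)"
  proof (rule Lim_transform_eventually)
    have "((\<lambda>x. (x ^ (Suc N - n) *\<^sub>R S x) \<bullet> c n) \<longlongrightarrow> (0 ^ (Suc N - n) *\<^sub>R L) \<bullet> c n) (at 0)"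
      by (intro tendsto_intros S)
    then show "((\<lambda>x. (x ^ (Suc N - n) *\<^sub>R S x) \<bullet> c n) \<longlongrightarrow> 0) (at 0)"
      using less.prems by (simp add: power_0_left)
    show "\<forall>\<^sub>F x in at 0. (x ^ (Suc N - n) *\<^sub>R S x) \<bullet> c n = g x"
      using f eventually_neq_at_within[of 0]
    proof eventually_elim
      case (elim x)
      then show ?case
        using less.prems by (simp add: g_def power_diff divide_inverse mult_ac)
    qed
  qed
  ultimately have "c n \<bullet> c n = 0"
    using tendsto_unique[OF trivial_limit_at] by fastforce
  then show ?case by simp
qed

text \<open>This is a Cauchy product in which one factor is a polynomial, so that convergence of the
  other factor suffices.\<close>

lemma power_series_convolution:
  fixes W :: "nat \<Rightarrow> real^'n^'m" and x :: real
  assumes "(\<lambda>n. x ^ n *\<^sub>R W n) sums K"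
  shows "(\<lambda>n. x ^ n *\<^sub>R (\<Sum>k\<le>N. if k \<le> n then W (n - k) *v v k else 0))
           sums (K *v (\<Sum>k\<le>N. x ^ k *\<^sub>R v k))"
proof -
  have lin: "bounded_linear (\<lambda>W::real^'n^'m. W *v u)" for u
    by (intro linear_conv_bounded_linear[THEN iffD1] linearI)
       (simp_all add: matrix_vector_mult_add_rdistrib scaleR_matrix_vector_assoc)
  have "(\<lambda>n. x ^ n *\<^sub>R (if k \<le> n then W (n - k) *v v k else 0)) sums (x ^ k *\<^sub>R (K *v v k))" for k
  proof -
    have "(\<lambda>n. x ^ k *\<^sub>R ((x ^ n *\<^sub>R W n) *v v k)) sums (x ^ k *\<^sub>R (K *v v k))"
      by (intro sums_scaleR_right bounded_linear.sums[OF lin] assms)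
    then have "(\<lambda>n. x ^ (n + k) *\<^sub>R (if k \<le> n + k then W (n + k - k) *v v k else 0))
        sums (x ^ k *\<^sub>R (K *v v k))"
      by (simp add: power_add mult_ac flip: scaleR_matrix_vector_assoc)
    then show ?thesis
      by (subst (asm) sums_iff_shift) simp
  qed
  then have "(\<lambda>n. \<Sum>k\<le>N. x ^ n *\<^sub>R (if k \<le> n then W (n - k) *v v k else 0))
      sums (\<Sum>k\<le>N. x ^ k *\<^sub>R (K *v v k))"
    by (intro sums_sum)
  then show ?thesis
    by (simp add: scaleR_sum_right matrix_vector_mult_scaleR
        linear_sum[OF matrix_vector_mul_linear])
qed

section \<open>Generating functions of Runge-Kutta stages\<close>

text \<open>The geometric series \<open>x / (1 - x)\<close> performs the summation over previous steps. The
  slopes from steps up to \<open>N\<close>, weighted by \<open>\<tau> \<beta>\<close>, add up to \<open>z (Suc N)\<close>; they contribute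
  this same amount to every order beyond \<open>N\<close>, which is the last term.\<close>

lemma rk_truncated_generating_function:
  fixes z :: "nat \<Rightarrow> 'a::real_vector" and Z Z' :: "nat \<Rightarrow> 's::finite \<Rightarrow> 'a"
    and \<A> :: "real^'s^'s" and \<beta> :: "real^'s"
  assumes x: "x \<noteq> 1" and z0: "z 0 = 0"
    and zS: "\<And>n. z (Suc n) = z n + \<tau> *\<^sub>R (\<Sum>j\<in>UNIV. \<beta> $ j *\<^sub>R Z' n j)"
    and Z: "\<And>n i. Z n i = z n + \<tau> *\<^sub>R (\<Sum>j\<in>UNIV. \<A> $ i $ j *\<^sub>R Z' n j)"
  shows "\<tau> *\<^sub>R (\<Sum>j\<in>UNIV. ((x / (1 - x)) *\<^sub>R outer 1 \<beta> + \<A>) $ i $ j *\<^sub>R (\<Sum>n\<le>N. x ^ n *\<^sub>R Z' n j))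
    = (\<Sum>n\<le>N. x ^ n *\<^sub>R Z n i) + (x ^ Suc N / (1 - x)) *\<^sub>R z (Suc N)"
proof -
  define q where "q = x / (1 - x)"
  have q: "1 + q = 1 / (1 - x)"
    using x by (simp add: q_def field_simps)
  \<comment> \<open>The right-hand side is arranged so that the terms in \<open>z\<close> telescope after
    multiplication by \<open>x ^ n\<close>, because \<open>q = x (1 + q)\<close>.\<close>
  have step: "\<tau> *\<^sub>R (\<Sum>j\<in>UNIV. (q *\<^sub>R outer 1 \<beta> + \<A>) $ i $ j *\<^sub>R Z' n j)
      = Z n i + q *\<^sub>R z (Suc n) - (1 + q) *\<^sub>R z n" for n
  proof -
    have "\<tau> *\<^sub>R (\<Sum>j\<in>UNIV. (q *\<^sub>R outer 1 \<beta> + \<A>) $ i $ j *\<^sub>R Z' n j)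
        = q *\<^sub>R (\<tau> *\<^sub>R (\<Sum>j\<in>UNIV. \<beta> $ j *\<^sub>R Z' n j))
          + \<tau> *\<^sub>R (\<Sum>j\<in>UNIV. \<A> $ i $ j *\<^sub>R Z' n j)"
      by (simp add: outer_def scaleR_left_distrib sum.distrib scaleR_right_distrib
          scaleR_sum_right mult_ac)
    then show ?thesis
      unfolding zS Z by (simp add: algebra_simps)
  qed
  have "\<tau> *\<^sub>R (\<Sum>j\<in>UNIV. (q *\<^sub>R outer 1 \<beta> + \<A>) $ i $ j *\<^sub>R (\<Sum>n\<le>N. x ^ n *\<^sub>R Z' n j))
      = (\<Sum>n\<le>N. x ^ n *\<^sub>R (\<tau> *\<^sub>R (\<Sum>j\<in>UNIV. (q *\<^sub>R outer 1 \<beta> + \<A>) $ i $ j *\<^sub>R Z' n j)))"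
    unfolding scaleR_sum_right by (subst sum.swap) (simp add: mult_ac)
  also have "\<dots> = (\<Sum>n\<le>N. x ^ n *\<^sub>R (Z n i + q *\<^sub>R z (Suc n) - (1 + q) *\<^sub>R z n))"
    by (simp only: step)
  also have "\<dots> = (\<Sum>n\<le>N. x ^ n *\<^sub>R Z n i) + (x ^ Suc N / (1 - x)) *\<^sub>R z (Suc N)"
  proof (induction N)
    case 0
    show ?case by (simp add: z0 q_def)
  next
    case (Suc N)
    have "x ^ Suc N * q = x ^ Suc (Suc N) / (1 - x)"
      by (simp add: q_def)
    with Suc show ?case
      by (simp add: q algebra_simps)
  qed
  finally show ?thesis
    by (simp add: q_def)
qed

theorem lemma3p3:
  fixes M :: "real^'p \<Rightarrow> real^'p^'p" and F :: "real^'p \<Rightarrow> real^'p"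
    and E A :: "real^'q^'q" and B C :: "real^'p^'q"
    and \<A> :: "real^'s^'s" and \<beta> :: "real^'s" and \<tau> :: real
    and y :: "nat \<Rightarrow> real^'p" and z :: "nat \<Rightarrow> real^'q"
    and Y Y' :: "nat \<Rightarrow> 's \<Rightarrow> real^'p" and Z Z' :: "nat \<Rightarrow> 's \<Rightarrow> real^'q"
    and W :: "nat \<Rightarrow> real^('s \<times> 'p)^('s \<times> 'p)"
  assumes "\<tau> > 0"
    and "invertible \<A>"
    and "invertible (((1 / \<tau>) *\<^sub>R matrix_inv \<A>) \<otimes>\<^sub>K E + mat 1 \<otimes>\<^sub>K A)"
    and "y 0 = 0" and "z 0 = 0"
    and "\<And>n. y (Suc n) = y n + \<tau> *\<^sub>R (\<Sum>j\<in>UNIV. \<beta> $ j *\<^sub>R Y' n j)"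
    and "\<And>n. z (Suc n) = z n + \<tau> *\<^sub>R (\<Sum>j\<in>UNIV. \<beta> $ j *\<^sub>R Z' n j)"
    and "\<And>n i. Y n i = y n + \<tau> *\<^sub>R (\<Sum>j\<in>UNIV. \<A> $ i $ j *\<^sub>R Y' n j)"
    and "\<And>n i. Z n i = z n + \<tau> *\<^sub>R (\<Sum>j\<in>UNIV. \<A> $ i $ j *\<^sub>R Z' n j)"
    and "\<And>n j. M (Y n j) *v Y' n j + F (Y n j) = transpose C *v Z n j"
    and "\<And>n j. E *v Z' n j + A *v Z n j = B *v Y n j"
    and "has_power_series_at_0 (\<lambda>\<xi>. Khat E A B C ((1 / \<tau>) *\<^sub>R rk_Delta \<A> \<beta> \<xi>)) W"
  shows "\<forall>n. y (Suc n) = y n + \<tau> *\<^sub>R (\<Sum>j\<in>UNIV. \<beta> $ j *\<^sub>R Y' n j) \<and>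
    (\<forall>i. M (Y n i) *v Y' n i + F (Y n i)
           = (\<Sum>k=0..n. \<Sum>j\<in>UNIV. block (W (n - k)) i j *v Y k j) \<and>
         Y n i = y n + \<tau> *\<^sub>R (\<Sum>j\<in>UNIV. \<A> $ i $ j *\<^sub>R Y' n j))"
proof -
  note tau = assms(1) and invA = assms(2) and invG = assms(3) and z0 = assms(5)
    and zS = assms(7) and Zeq = assms(9) and constraint = assms(11)
  define D where "D x = (x / (1 - x)) *\<^sub>R outer 1 \<beta> + \<A>" for x :: real
  define X where "X x = (1 / \<tau>) *\<^sub>R rk_Delta \<A> \<beta> x" for x
  define G where "G x = X x \<otimes>\<^sub>K E + mat 1 \<otimes>\<^sub>K A" for x
  have Delta: "rk_Delta \<A> \<beta> x = matrix_inv (D x)" for x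
    by (simp add: rk_Delta_def D_def)
  have "(D \<longlongrightarrow> (0 / (1 - 0)) *\<^sub>R outer 1 \<beta> + \<A>) (at 0)"
    unfolding D_def by (intro tendsto_intros) simp
  then have D_lim: "(D \<longlongrightarrow> \<A>) (at 0)"
    by simp
  have X_lim: "(X \<longlongrightarrow> (1 / \<tau>) *\<^sub>R matrix_inv \<A>) (at 0)"
    unfolding X_def Delta by (intro tendsto_scaleR tendsto_const tendsto_matrix_inv D_lim invA)
  have G_lim: "(G \<longlongrightarrow> ((1 / \<tau>) *\<^sub>R matrix_inv \<A>) \<otimes>\<^sub>K E + mat 1 \<otimes>\<^sub>K A) (at 0)"
    unfolding G_def by (intro tendsto_add tendsto_kron X_lim tendsto_const)
  obtain r where r: "r > 0"
    and W: "\<And>x. \<bar>x\<bar> < r \<Longrightarrow> (\<lambda>n. x ^ n *\<^sub>R W n) sums Khat E A B C (X x)"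
    using assms(12) unfolding has_power_series_at_0_def X_def by blast

  have conv: "transpose C *v Z N i = (\<Sum>k=0..N. \<Sum>j\<in>UNIV. block (W (N - k)) i j *v Y k j)" for N i
  proof -
    \<comment> \<open>Generating polynomials, truncated after the order \<open>N\<close> of the coefficient to be found.\<close>
    define Yp where "Yp x = (\<lambda>i. \<Sum>n\<le>N. x ^ n *\<^sub>R Y n i)" for x :: real
    define Zp where "Zp x = (\<lambda>i. \<Sum>n\<le>N. x ^ n *\<^sub>R Z n i)" for x :: real
    define Zp' where "Zp' x = (\<lambda>i. \<Sum>n\<le>N. x ^ n *\<^sub>R Z' n i)" for x :: real
    define R :: "real \<Rightarrow> real^('s \<times> 'q)"
      where "R x = stack (\<lambda>_. (1 / (1 - x)) *\<^sub>R z (Suc N))" for x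
    define T where "T x = matrix_inv (G x) *v ((X x \<otimes>\<^sub>K E) *v R x)" for x
    define S where "S x = (mat 1 \<otimes>\<^sub>K transpose C) *v T x" for x
    \<comment> \<open>The defect \<open>f\<close> of the identity for the truncated functions, and its coefficients.\<close>
    define f where "f x = Khat E A B C (X x) *v stack (Yp x)
      - (mat 1 \<otimes>\<^sub>K transpose C) *v stack (Zp x)" for x
    define c where "c n = (\<Sum>k\<le>N. if k \<le> n then W (n - k) *v stack (Y k) else 0)
      - (if n \<le> N then stack (\<lambda>i. transpose C *v Z n i) else 0)" for n

    have sums: "(\<lambda>n. x ^ n *\<^sub>R c n) sums f x" if "\<bar>x\<bar> < r" for x
    proof -
      have Y_part: "(\<lambda>n. x ^ n *\<^sub>R (\<Sum>k\<le>N. if k \<le> n then W (n - k) *v stack (Y k) else 0))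
          sums (Khat E A B C (X x) *v stack (Yp x))"
        using power_series_convolution[OF W[OF that], where N = N and v = "\<lambda>k. stack (Y k)"]
        by (simp add: Yp_def stack_scaleR stack_sum)
      have "(\<Sum>n\<le>N. x ^ n *\<^sub>R stack (\<lambda>i. transpose C *v Z n i))
          = (mat 1 \<otimes>\<^sub>K transpose C) *v stack (Zp x)"
        by (simp add: kron_mat1_mult_stack Zp_def stack_scaleR stack_sum
            matrix_vector_mult_scaleR linear_sum[OF matrix_vector_mul_linear])
      then have Z_part: "(\<lambda>n. if n \<in> {..N} then x ^ n *\<^sub>R stack (\<lambda>i. transpose C *v Z n i) else 0)
          sums ((mat 1 \<otimes>\<^sub>K transpose C) *v stack (Zp x))"
        using sums_If_finite_set[of "{..N}"
            "\<lambda>n. x ^ n *\<^sub>R stack (\<lambda>i. transpose C *v Z n i)"] by simp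
      show ?thesis
        using sums_diff[OF Y_part Z_part] unfolding f_def c_def
        by (rule back_subst[of "\<lambda>a. a sums _"]) (auto simp: scaleR_diff_right)
    qed

    have remainder: "\<forall>\<^sub>F x in at 0. f x = x ^ Suc N *\<^sub>R S x"
    proof -
      have "\<forall>\<^sub>F x in at (0::real). x \<noteq> 1"
        by (rule tendsto_imp_eventually_ne[OF tendsto_ident_at]) simp
      then show ?thesis
        using eventually_invertible[OF D_lim invA] eventually_invertible[OF G_lim invG]
      proof eventually_elim
        case (elim x)
        have "X x ** (\<tau> *\<^sub>R D x) = mat 1"
          using tau matrix_inv_left[OF elim(2)]
          by (simp add: X_def Delta matrix_scalar_ac flip: scalar_matrix_assoc)
        \<comment> \<open>Applying \<open>\<Delta> / \<tau>\<close> to the relation between stages and slopes expresses the slopes by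
          the stages and the remainder.\<close>
        from kron_mult_stack_cancel[OF this, of E "Zp' x"]
        have "(X x \<otimes>\<^sub>K E) *v stack (\<lambda>i. \<tau> *\<^sub>R (\<Sum>j\<in>UNIV. D x $ i $ j *\<^sub>R Zp' x j))
            = stack (\<lambda>i. E *v Zp' x i)"
          by (simp add: scaleR_sum_right)
        then have "(X x \<otimes>\<^sub>K E) *v (stack (Zp x) + x ^ Suc N *\<^sub>R R x) = stack (\<lambda>i. E *v Zp' x i)"
          unfolding D_def Zp'_def rk_truncated_generating_function[OF elim(1) z0 zS Zeq]
          by (simp add: R_def Zp_def stack_add stack_scaleR)
        moreover have "E *v Zp' x i + A *v Zp x i = B *v Yp x i" for i
          by (simp add: Zp'_def Zp_def Yp_def linear_sum[OF matrix_vector_mul_linear]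
              matrix_vector_mult_scaleR constraint flip: sum.distrib scaleR_right_distrib)
        ultimately have "G x *v stack (Zp x) + x ^ Suc N *\<^sub>R ((X x \<otimes>\<^sub>K E) *v R x)
            = (mat 1 \<otimes>\<^sub>K B) *v stack (Yp x)"
          by (simp add: G_def matrix_vector_mult_add_rdistrib kron_mat1_mult_stack
              matrix_vector_right_distrib matrix_vector_mult_scaleR
              stack_add algebra_simps)
        then have "matrix_inv (G x) *v (G x *v stack (Zp x)) + x ^ Suc N *\<^sub>R T x
            = matrix_inv (G x) *v ((mat 1 \<otimes>\<^sub>K B) *v stack (Yp x))"
          unfolding T_def
          by (metis matrix_vector_right_distrib matrix_vector_mult_scaleR)
        then have "stack (Zp x) = matrix_inv (G x) *v ((mat 1 \<otimes>\<^sub>K B) *v stack (Yp x))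
            - x ^ Suc N *\<^sub>R T x"
          using matrix_inv_left[OF elim(3)]
          by (simp add: matrix_vector_mul_assoc eq_diff_eq)
        then show "f x = x ^ Suc N *\<^sub>R S x"
          by (simp add: f_def S_def Khat_def G_def matrix_vector_mult_diff_distrib
              matrix_vector_mult_scaleR matrix_vector_mul_assoc matrix_mul_assoc)
      qed
    qed

    have "(R \<longlongrightarrow> stack (\<lambda>_. (1 / (1 - 0)) *\<^sub>R z (Suc N))) (at 0)"
      unfolding R_def stack_def by (intro tendsto_intros) simp
    note S_lim = tendsto_matrix_vector_mult[OF tendsto_const[of "mat 1 \<otimes>\<^sub>K transpose C"]
        tendsto_matrix_vector_mult[OF tendsto_matrix_inv[OF G_lim invG]
          tendsto_matrix_vector_mult[OF tendsto_kron[OF X_lim, of E] this]],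
        folded T_def, folded S_def]

    have "c N = 0"
      by (rule power_series_coeff_eq_0[OF r sums remainder S_lim]) simp_all
    then have "stack (\<lambda>i. transpose C *v Z N i) = (\<Sum>k\<le>N. W (N - k) *v stack (Y k))"
      by (simp add: c_def)
    then have "stack (\<lambda>i. transpose C *v Z N i) $ (i, a)
        = (\<Sum>k\<le>N. W (N - k) *v stack (Y k)) $ (i, a)" for a
      by simp
    then show ?thesis
      by (simp add: stack_nth matrix_mult_stack_nth vec_eq_iff atLeast0AtMost)
  qed
  show ?thesis
    using conv assms by simp
qed

end
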